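(* For every fixed integer $\ell\ge1$, $$D_\ell(x)=\frac{\sqrt{2\ell x}}{\log^2 x}+O_\ell\!\left(\frac{\sqrt{x}}{\log^3 x}\right),\qquad x\to\infty.$$
   Context: For an integer $\ell\ge1$ and $n\ge 1$ put $L_n^{(\ell)}=\frac{n(\ell(n-1)+2)}{2}$ and $h_n^{(\ell)}=L_{n+1}^{(\ell)}-L_n^{(\ell)}=1+\ell n$. For real $x$ let $\nu_\ell(x)=\frac{\sqrt{8\ell x+(\ell-2)^2}+\ell-2}{2\ell}$ and $n_x^{(\ell)}=\lceil \nu_\ell(x)\rceil$ (so with $n=n_x^{(\ell)}$ one has $L_{n-1}^{(\ell)}<x\le L_n^{(\ell)}$). For $j\ge1$ let $s_j^{(\ell)}=h_j^{(\ell)}/\log L_{j+1}^{(\ell)}$ and $\Sigma_n^{(\ell)}=\sum_{j=1}^{n-1}s_j^{(\ell)}$. For $x\ge L_2^{(\ell)}$ the ceiling estimator is $$\widehat S_\ell(x)=\Sigma_{n_x^{(\ell)}}^{(\ell)}-\frac{L_{n_x^{(\ell)}}^{(\ell)}-x}{\log L_{n_x^{(\ell)}}^{(\ell)}}.$$ Let $\operatorname{li}(x)=\mathrm{PV}\!\int_0^x\frac{dt}{\log t}$ (principal value) and $D_\ell(x)=\operatorname{li}(x)-\widehat S_\ell(x)$. The implied constant in $O_\ell$ may depend on $\ell$ but not on $x$. *)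

theory Defs
  imports "HOL-Analysis.Analysis" "HOL-Library.Landau_Symbols"
begin

definition L :: "nat \<Rightarrow> nat \<Rightarrow> real" where
  "L l n = real n * (real l * (real n - 1) + 2) / 2"

definition h :: "nat \<Rightarrow> nat \<Rightarrow> real" where
  "h l n = L l (n + 1) - L l n"

lemma h_eq: "h l n = 1 + real l * real n"
  by (simp add: h_def L_def field_simps)

definition nu :: "nat \<Rightarrow> real \<Rightarrow> real" where
  "nu l x = (sqrt (8 * real l * x + (real l - 2)\<^sup>2) + real l - 2) / (2 * real l)"

text \<open>For \<open>l \<ge> 1\<close> and \<open>x > 0\<close> the ceiling is positive, so \<open>nat\<close> does not truncate.\<close>

definition n_idx :: "nat \<Rightarrow> real \<Rightarrow> nat" where
  "n_idx l x = nat \<lceil>nu l x\<rceil>"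

definition s :: "nat \<Rightarrow> nat \<Rightarrow> real" where
  "s l j = h l j / ln (L l (j + 1))"

definition Sigma_sum :: "nat \<Rightarrow> nat \<Rightarrow> real" where
  "Sigma_sum l n = (\<Sum>j = 1..<n. s l j)"

text \<open>Only the values at \<open>x \<ge> L l 2\<close> are meaningful.\<close>

definition S_hat :: "nat \<Rightarrow> real \<Rightarrow> real" where
  "S_hat l x = Sigma_sum l (n_idx l x) - (L l (n_idx l x) - x) / ln (L l (n_idx l x))"

text \<open>The principal value removes a symmetric neighbourhood of the pole at \<open>1\<close>. The integrand
  tends to \<open>0\<close> at \<open>0\<close>, where it also has the value \<open>0\<close> because \<open>ln 0 = 0\<close> and \<open>1 / 0 = 0\<close>.\<close>

definition li :: "real \<Rightarrow> real" where
  "li x = Lim (at_right 0) (\<lambda>\<epsilon>. integral ({0..x} - {1 - \<epsilon><..<1 + \<epsilon>}) (\<lambda>t. 1 / ln t))"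

definition D :: "nat \<Rightarrow> real \<Rightarrow> real" where
  "D l x = li x - S_hat l x"

end

theory Submission
  imports Defs "HOL-Real_Asymp.Real_Asymp"
begin

text \<open>
  On \<open>[L\<^sub>n, L\<^sub>n\<^sub>+\<^sub>1]\<close> the estimator replaces \<open>1 / ln t\<close> by its value at the right end, so by
  Taylor's theorem the error there is \<open>h\<^sub>n\<^sup>2 / (2 \<xi> (ln \<xi>)\<^sup>2)\<close> for some \<open>\<xi>\<close> in the interval. Since
  \<open>h\<^sub>n\<^sup>2 / (2 L\<^sub>n) = l + O(1/n)\<close>, it agrees with the increment of \<open>l n / (ln L\<^sub>n)\<^sup>2\<close> up to a constant
  times the increment of \<open>n / (ln L\<^sub>n)\<^sup>3\<close>. Telescoping gives the claim at \<open>x = L\<^sub>n\<close>, and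
  replacing \<open>L\<^sub>n\<close> by a point \<open>x\<close> of \<open>(L\<^sub>n\<^sub>-\<^sub>1, L\<^sub>n]\<close> costs only \<open>O(1)\<close>.
\<close>

section \<open>The logarithmic integral near and beyond its pole\<close>

text \<open>The function \<open>1 / ln\<close> with its pole at \<open>1\<close> removed; the symmetric principal value of the
  removed part \<open>1 / (t - 1)\<close> over \<open>[0, x]\<close> is \<open>ln (x - 1)\<close>.\<close>

definition li_reg :: "real \<Rightarrow> real" where
  "li_reg t = (if t = 1 then 1 / 2 else 1 / ln t - 1 / (t - 1))"

text \<open>At 0 the limit is \<open>1\<close>, which agrees with the value computed from
  \<open>ln 0 = 0\<close> and \<open>1 / 0 = 0\<close>. At 1 the expansion
  \<open>ln t = (t - 1) - (t - 1)^2 / 2 + ...\<close> gives the limit \<open>1 / 2\<close>.\<close>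

lemma continuous_on_li_reg: "continuous_on {0..} li_reg"
proof -
  have "(li_reg \<longlongrightarrow> li_reg x) (at x within {0..})" if "x \<ge> 0" for x
  proof -
    consider "x = 0" | "x = 1" | "x > 0" "x \<noteq> 1" using \<open>x \<ge> 0\<close> by linarith
    then show ?thesis
    proof cases
      case 1
      have "((\<lambda>t. 1 / ln t - 1 / (t - 1)) \<longlongrightarrow> 1) (at_right (0::real))"
        by real_asymp
      moreover have "\<forall>\<^sub>F t in at_right (0::real). 1 / ln t - 1 / (t - 1) = li_reg t"
        unfolding eventually_at_right_field by (intro exI[of _ 1]) (auto simp: li_reg_def)
      ultimately have "(li_reg \<longlongrightarrow> 1) (at_right 0)"
        by (rule Lim_transform_eventually)
      then show ?thesis
        using 1 by (simp add: at_within_Ici_at_right li_reg_def)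
    next
      case 2
      have "((\<lambda>t::real. 1 / ln t - 1 / (t - 1)) \<longlongrightarrow> 1 / 2) (at 1)"
        unfolding at_eq_sup_left_right by (intro filterlim_sup; real_asymp)
      moreover have "\<forall>\<^sub>F t in at (1::real). 1 / ln t - 1 / (t - 1) = li_reg t"
        by (auto simp: eventually_at_filter li_reg_def)
      ultimately have "(li_reg \<longlongrightarrow> 1 / 2) (at 1)"
        by (rule Lim_transform_eventually)
      then show ?thesis
        using 2 by (auto simp: li_reg_def intro: tendsto_within_subset)
    next
      case 3
      have "((\<lambda>t. 1 / ln t - 1 / (t - 1)) \<longlongrightarrow> 1 / ln x - 1 / (x - 1)) (at x)"
        using 3 by (intro tendsto_intros) auto
      moreover have "\<forall>\<^sub>F t in at x. t \<noteq> 1"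
        using 3 by (intro tendsto_imp_eventually_ne[OF tendsto_ident_at])
      then have "\<forall>\<^sub>F t in at x. 1 / ln t - 1 / (t - 1) = li_reg t"
        by eventually_elim (simp add: li_reg_def)
      ultimately have "(li_reg \<longlongrightarrow> 1 / ln x - 1 / (x - 1)) (at x)"
        by (rule Lim_transform_eventually)
      then show ?thesis
        using 3 by (auto simp: li_reg_def intro: tendsto_within_subset)
    qed
  qed
  then show ?thesis
    unfolding continuous_on_def by auto
qed

lemma li_reg_integrable: "a \<ge> 0 \<Longrightarrow> li_reg integrable_on {a..b}"
  by (rule integrable_continuous_real, rule continuous_on_subset[OF continuous_on_li_reg]) auto

text \<open>The pole part contributes \<open>ln \<epsilon>\<close> on the left and
  \<open>ln (x - 1) - ln \<epsilon>\<close> on the right. Because the gap is symmetric, the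
  divergent terms cancel.\<close>

lemma integral_li_truncated:
  assumes "0 < \<epsilon>" "\<epsilon> < 1" "\<epsilon> < x - 1"
  shows "integral ({0..x} - {1 - \<epsilon><..<1 + \<epsilon>}) (\<lambda>t. 1 / ln t) =
         integral {0..1 - \<epsilon>} li_reg + integral {1 + \<epsilon>..x} li_reg + ln (x - 1)"
proof -
  \<comment> \<open>Left of the pole \<open>ln (1 - t)\<close> serves as antiderivative, and it
    vanishes at 0.\<close>
  have "((\<lambda>t. 1 / (t - 1)) has_integral ln (1 - (1 - \<epsilon>)) - ln (1 - 0)) {0..1 - \<epsilon>}"
    using assms
    by (intro fundamental_theorem_of_calculus)
       (auto intro!: derivative_eq_intros simp: field_simps
             simp flip: has_real_derivative_iff_has_vector_derivative)
  then have pole: "((\<lambda>t. 1 / (t - 1)) has_integral ln \<epsilon>) {0..1 - \<epsilon>}"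
    by simp
  have "(li_reg has_integral integral {0..1 - \<epsilon>} li_reg) {0..1 - \<epsilon>}"
    by (intro integrable_integral li_reg_integrable) simp
  note int = has_integral_add[OF this pole]
  have left: "((\<lambda>t. 1 / ln t) has_integral integral {0..1 - \<epsilon>} li_reg + ln \<epsilon>) {0..1 - \<epsilon>}"
    by (rule has_integral_eq[OF _ int]) (use assms in \<open>simp add: li_reg_def\<close>)
  have "((\<lambda>t. 1 / (t - 1)) has_integral ln (x - 1) - ln (1 + \<epsilon> - 1)) {1 + \<epsilon>..x}"
    using assms
    by (intro fundamental_theorem_of_calculus)
       (auto intro!: derivative_eq_intros
             simp flip: has_real_derivative_iff_has_vector_derivative)
  then have pole: "((\<lambda>t. 1 / (t - 1)) has_integral ln (x - 1) - ln \<epsilon>) {1 + \<epsilon>..x}"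
    by simp
  have "(li_reg has_integral integral {1 + \<epsilon>..x} li_reg) {1 + \<epsilon>..x}"
    using assms by (intro integrable_integral li_reg_integrable) simp
  note int = has_integral_add[OF this pole]
  have right: "((\<lambda>t. 1 / ln t) has_integral integral {1 + \<epsilon>..x} li_reg + (ln (x - 1) - ln \<epsilon>))
      {1 + \<epsilon>..x}"
    by (rule has_integral_eq[OF _ int]) (use assms in \<open>simp add: li_reg_def\<close>)
  have "{0..x} - {1 - \<epsilon><..<1 + \<epsilon>} = {0..1 - \<epsilon>} \<union> {1 + \<epsilon>..x}"
    using assms by auto
  moreover have "{0..1 - \<epsilon>} \<inter> {1 + \<epsilon>..x} = {}"
    using assms by auto
  ultimately show ?thesis
    using has_integral_Un[OF left right] by (simp add: integral_unique)
qed

text \<open>The indefinite integral of a continuous function is continuous, so the gap around 1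
  closes in the limit \<epsilon> -> 0.\<close>

lemma li_eq_integral_li_reg:
  assumes "x > 1"
  shows "li x = integral {0..x} li_reg + ln (x - 1)"
proof -
  define I where "I = (\<lambda>y. integral {0..y} li_reg)"
  have I: "continuous_on {0..x} I"
    unfolding I_def by (intro indefinite_integral_continuous_1 li_reg_integrable) simp
  have "isCont I 1"
    using continuous_on_interior[OF I] assms by simp
  then have "((\<lambda>\<epsilon>. I (1 - \<epsilon>) + (I x - I (1 + \<epsilon>)) + ln (x - 1)) \<longlongrightarrow>
      I 1 + (I x - I 1) + ln (x - 1)) (at_right 0)"
    by (intro tendsto_intros isCont_tendsto_compose[where g = I]) (auto intro!: tendsto_eq_intros)
  moreover have "\<forall>\<^sub>F \<epsilon> in at_right 0. I (1 - \<epsilon>) + (I x - I (1 + \<epsilon>)) + ln (x - 1) =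
      integral ({0..x} - {1 - \<epsilon><..<1 + \<epsilon>}) (\<lambda>t. 1 / ln t)"
    unfolding eventually_at_right_field
  proof (intro exI[of _ "min 1 (x - 1)"] conjI allI impI)
    fix \<epsilon> :: real
    assume \<epsilon>: "0 < \<epsilon>" "\<epsilon> < min 1 (x - 1)"
    have "I (1 + \<epsilon>) + integral {1 + \<epsilon>..x} li_reg = I x"
      unfolding I_def using \<epsilon>
      by (intro Henstock_Kurzweil_Integration.integral_combine li_reg_integrable) auto
    then show "I (1 - \<epsilon>) + (I x - I (1 + \<epsilon>)) + ln (x - 1) =
        integral ({0..x} - {1 - \<epsilon><..<1 + \<epsilon>}) (\<lambda>t. 1 / ln t)"
      using integral_li_truncated[of \<epsilon> x] \<epsilon> by (simp add: I_def)
  qed (use assms in auto)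
  ultimately have "((\<lambda>\<epsilon>. integral ({0..x} - {1 - \<epsilon><..<1 + \<epsilon>}) (\<lambda>t. 1 / ln t)) \<longlongrightarrow>
      I 1 + (I x - I 1) + ln (x - 1)) (at_right 0)"
    by (rule Lim_transform_eventually)
  then show ?thesis
    unfolding li_def by (subst tendsto_Lim) (auto simp: I_def)
qed

lemma DERIV_li:
  assumes "x > 1"
  shows "(li has_real_derivative 1 / ln x) (at x)"
proof -
  have "((\<lambda>y. integral {0..y} li_reg) has_real_derivative li_reg x) (at x within {0..x + 1})"
    using assms by (intro integral_has_real_derivative continuous_on_subset[OF continuous_on_li_reg]) auto
  then have "((\<lambda>y. integral {0..y} li_reg) has_real_derivative li_reg x) (at x)"
    using assms at_within_Icc_at[of 0 x "x + 1"] by simp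
  then have "((\<lambda>y. integral {0..y} li_reg + ln (y - 1)) has_real_derivative 1 / ln x) (at x)"
    using assms by (auto intro!: derivative_eq_intros simp: li_reg_def)
  then show ?thesis
    by (rule has_field_derivative_transform_within_open[where S = "{1<..}"])
      (use assms in \<open>auto simp: li_eq_integral_li_reg\<close>)
qed

section \<open>Error of the right endpoint rule\<close>

lemma li_taylor:
  assumes "1 < a" "a < b"
  obtains \<xi> where "a < \<xi>" "\<xi> < b"
    "li b - li a - (b - a) / ln b = (b - a)\<^sup>2 / (2 * \<xi> * (ln \<xi>)\<^sup>2)"
proof -
  \<comment> \<open>Derivatives of \<open>li\<close> up to order 2; the last branch also covers
    larger \<open>m\<close>, where it is only a filler value.\<close>
  define diff where
    "diff m = (if m = 0 then li else if m = 1 then (\<lambda>t. 1 / ln t) else (\<lambda>t. - 1 / (t * (ln t)\<^sup>2)))" for m :: nat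
  have "(diff m has_real_derivative diff (Suc m) t) (at t)" if "m < 2" "a \<le> t" for m t
  proof -
    have "m = 0 \<or> m = 1" using that by linarith
    moreover have "((\<lambda>t. 1 / ln t) has_real_derivative - 1 / (t * (ln t)\<^sup>2)) (at t)"
      using that assms by (auto intro!: derivative_eq_intros simp: field_simps power2_eq_square)
    ultimately show ?thesis
      using DERIV_li[of t] that assms by (auto simp: diff_def)
  qed
  \<comment> \<open>The expansion point is the right end \<open>b\<close>, so that the linear term
    carries the factor \<open>1 / ln b\<close> of the estimator.\<close>
  with Taylor_down[of 2 diff li a b b] assms
  obtain \<xi> where \<xi>: "a < \<xi>" "\<xi> < b"
    "li a = (\<Sum>m<2. diff m b / fact m * (a - b) ^ m) + diff 2 \<xi> / fact 2 * (a - b)\<^sup>2"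
    by (auto simp: diff_def)
  have "(a - b)\<^sup>2 = (b - a)\<^sup>2" by (simp add: power2_commute)
  then have "li b - li a - (b - a) / ln b = (b - a)\<^sup>2 / (2 * \<xi> * (ln \<xi>)\<^sup>2)"
    using \<xi>(3) by (simp add: diff_def numeral_2_eq_2 diff_divide_distrib algebra_simps)
  with \<xi> that show ?thesis by blast
qed

text \<open>The unknown \<open>\<xi>\<close> is replaced by either end, since
  \<open>t * (ln t)^2\<close> increases for \<open>t > 1\<close>. Equality \<open>a = b\<close> is
  allowed for the case where \<open>x\<close> is itself some \<open>L l n\<close>.\<close>

lemma li_increment_bounds:
  assumes "1 < a" "a \<le> b"
  shows "(b - a)\<^sup>2 / (2 * b * (ln b)\<^sup>2) \<le> li b - li a - (b - a) / ln b"
    and "li b - li a - (b - a) / ln b \<le> (b - a)\<^sup>2 / (2 * a * (ln a)\<^sup>2)"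
proof -
  have "(b - a)\<^sup>2 / (2 * b * (ln b)\<^sup>2) \<le> li b - li a - (b - a) / ln b \<and>
    li b - li a - (b - a) / ln b \<le> (b - a)\<^sup>2 / (2 * a * (ln a)\<^sup>2)"
  proof (cases "a = b")
    case False
    with assms obtain \<xi> where \<xi>: "a < \<xi>" "\<xi> < b"
      "li b - li a - (b - a) / ln b = (b - a)\<^sup>2 / (2 * \<xi> * (ln \<xi>)\<^sup>2)"
      using li_taylor[of a b] by auto
    show ?thesis
      unfolding \<xi>(3) using \<xi>(1,2) assms
      by (intro conjI divide_left_mono mult_mono power_mono mult_pos_pos) auto
  qed auto
  then show "(b - a)\<^sup>2 / (2 * b * (ln b)\<^sup>2) \<le> li b - li a - (b - a) / ln b"
    and "li b - li a - (b - a) / ln b \<le> (b - a)\<^sup>2 / (2 * a * (ln a)\<^sup>2)" by auto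
qed

text \<open>Summing the increments bounds \<open>u n - u N\<close> by
  \<open>C * (G n - G N)\<close>. The leftover constant is absorbed by one more copy of
  \<open>G\<close>, which tends to infinity.\<close>

lemma bigo_telescoping:
  fixes u G :: "nat \<Rightarrow> real"
  assumes bound: "\<forall>\<^sub>F n in sequentially. \<bar>u (Suc n) - u n\<bar> \<le> C * (G (Suc n) - G n)"
    and G: "filterlim G at_top sequentially"
  shows "u \<in> O(G)"
proof -
  obtain N where N: "\<And>n. n \<ge> N \<Longrightarrow> \<bar>u (Suc n) - u n\<bar> \<le> C * (G (Suc n) - G n)"
    using bound by (auto simp: eventually_sequentially)
  have *: "\<bar>u n - u N\<bar> \<le> C * (G n - G N)" if "n \<ge> N" for n
    using that
  proof (induction n rule: dec_induct)
    case (step n)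
    then show ?case using N[of n] by (simp add: algebra_simps)
  qed simp
  \<comment> \<open>The threshold 0 removes the norm around \<open>G n\<close>; the threshold
    \<open>\<bar>u N\<bar> - C * G N\<close> is the constant to be absorbed.\<close>
  have "\<forall>\<^sub>F n in sequentially. norm (u n) \<le> (C + 1) * norm (G n)"
    using eventually_ge_at_top[of N] filterlim_at_top_dense[THEN iffD1, OF G, rule_format, of 0]
      filterlim_at_top_dense[THEN iffD1, OF G, rule_format, of "\<bar>u N\<bar> - C * G N"]
  proof eventually_elim
    case (elim n)
    then show ?case using *[of n] by (simp add: algebra_simps)
  qed
  then show ?thesis by (rule bigoI)
qed

section \<open>The points \<open>L l n\<close> and the asymptotics of one step\<close>

context
  fixes l :: nat
  assumes l: "l > 0"
begin

lemma L_Suc_bounds: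
  assumes "n > 0"
  shows "1 \<le> L l n" "L l n < L l (Suc n)"
proof -
  have "real n * (real l * (real n - 1) + 2) \<ge> 1 * (0 + 2)"
    using assms by (intro mult_mono add_mono mult_nonneg_nonneg) auto
  then show "1 \<le> L l n" by (simp add: L_def)
  have "h l n > 0" by (simp add: h_eq add_pos_nonneg)
  then show "L l n < L l (Suc n)" by (simp add: h_def)
qed

text \<open>The two bounds on the error of one step, with the denominator taken at the left and at
  the right end, are both compared with the increment of the main term \<open>F\<close>.\<close>

lemma increment_asymptotics:
  defines "F \<equiv> \<lambda>n. real l * real n / (ln (L l n))\<^sup>2"
  shows "(\<lambda>n. (h l n)\<^sup>2 / (2 * L l n * (ln (L l n))\<^sup>2) - (F (Suc n) - F n)) \<in> O(\<lambda>n. 1 / ln (real n) ^ 3)"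
    (is "?f1 \<in> _")
    and "(\<lambda>n. (h l n)\<^sup>2 / (2 * L l (Suc n) * (ln (L l (Suc n)))\<^sup>2) - (F (Suc n) - F n)) \<in> O(\<lambda>n. 1 / ln (real n) ^ 3)"
    (is "?f2 \<in> _")
proof -
  have split: "(p + 2 * a * real l) / (2 * a * q) = p / (2 * a * q) + real l / q" if "a > 0" for p a q
    using that by (simp add: add_divide_distrib)
  \<comment> \<open>Since \<open>h^2 = 2 * l * L + (1 + l^2 * n)\<close>, the quotient splits off
    \<open>l / (ln L)^2\<close>, which cancels exactly against the increment of \<open>F\<close>.
    What remains is of order \<open>1 / (n * (ln n)^2)\<close> plus a term of order
    \<open>1 / (ln n)^3\<close>, because \<open>ln L\<close> grows by about \<open>2 / n\<close> per
    step.\<close>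
  have "(\<lambda>n. (1 + (real l)\<^sup>2 * real n) / (2 * L l n * (ln (L l n))\<^sup>2) +
     real l * (real n + 1) * (1 / (ln (L l n))\<^sup>2 - 1 / (ln (L l (Suc n)))\<^sup>2)) \<in> O(\<lambda>n. 1 / ln (real n) ^ 3)"
    (is "?g1 \<in> _")
    unfolding L_def using l by real_asymp
  moreover have "\<forall>\<^sub>F n in sequentially. ?f1 n = ?g1 n"
    using eventually_gt_at_top[of 0]
  proof eventually_elim
    case (elim n)
    have "(h l n)\<^sup>2 = (1 + (real l)\<^sup>2 * real n) + 2 * L l n * real l"
      by (simp add: h_eq L_def field_simps power2_eq_square)
    then show ?case
      using L_Suc_bounds[OF elim] by (simp only: split F_def) (simp add: algebra_simps add_divide_distrib)
  qed
  ultimately show "?f1 \<in> O(\<lambda>n. 1 / ln (real n) ^ 3)"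
    using landau_o.big.in_cong[of ?f1 ?g1] by simp
  \<comment> \<open>The same cancellation, with \<open>h^2\<close> expanded around
    \<open>2 * l * L l (Suc n)\<close>.\<close>
  have "(\<lambda>n. (1 - (real l)\<^sup>2 * real n - 2 * real l) / (2 * L l (Suc n) * (ln (L l (Suc n)))\<^sup>2) +
     real l * real n * (1 / (ln (L l n))\<^sup>2 - 1 / (ln (L l (Suc n)))\<^sup>2)) \<in> O(\<lambda>n. 1 / ln (real n) ^ 3)"
    (is "?g2 \<in> _")
    unfolding L_def using l by (intro sum_in_bigo; real_asymp)
  moreover have "\<forall>\<^sub>F n in sequentially. ?f2 n = ?g2 n"
    using eventually_gt_at_top[of 0]
  proof eventually_elim
    case (elim n)
    have "(h l n)\<^sup>2 = (1 - (real l)\<^sup>2 * real n - 2 * real l) + 2 * L l (Suc n) * real l"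
      by (simp add: h_eq L_def field_simps power2_eq_square)
    then show ?case
      using L_Suc_bounds[OF elim] by (simp only: split F_def) (simp add: algebra_simps add_divide_distrib)
  qed
  ultimately show "?f2 \<in> O(\<lambda>n. 1 / ln (real n) ^ 3)"
    using landau_o.big.in_cong[of ?f2 ?g2] by simp
qed

text \<open>Since \<open>ln (L l n)\<close> is asymptotic to \<open>2 * ln n\<close>, the increments
  of \<open>G\<close> have order \<open>1 / (ln n)^3\<close>. So \<open>G\<close> can play the
  comparison role in \<open>bigo_telescoping\<close>.\<close>

lemma comparison_increment:
  defines "G \<equiv> \<lambda>n. real n / ln (L l n) ^ 3"
  shows "(\<lambda>n. 1 / ln (real n) ^ 3) \<in> O(\<lambda>n. G (Suc n) - G n)"
    and "\<forall>\<^sub>F n in sequentially. G (Suc n) - G n \<ge> 0"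
    and "filterlim G at_top sequentially"
  unfolding G_def L_def using l by real_asymp+

lemma step_error_bounded: "(\<lambda>n. (h l n)\<^sup>2 / (2 * L l n * (ln (L l n))\<^sup>2)) \<in> O(\<lambda>_. 1)"
  unfolding L_def h_eq using l by real_asymp

lemma main_term_step_bounded: "(\<lambda>n. real l * real (Suc n) * (1 / (ln (L l n))\<^sup>2 - 1 / (ln (L l (Suc n)))\<^sup>2)) \<in> O(\<lambda>_. 1)"
  unfolding L_def using l by real_asymp

section \<open>The index of the interval that contains x\<close>

lemma filterlim_nu: "filterlim (nu l) at_top at_top"
  unfolding nu_def using l by real_asymp

text \<open>\<open>nu l x\<close> is the larger root of the quadratic equation
  \<open>L l n = x\<close> in \<open>n\<close>. Completing the square gives the claim;
  \<open>n \<ge> 1\<close> makes the side to be squared nonnegative.\<close>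

lemma nu_le_iff:
  assumes "x \<ge> 0" "real n \<ge> 1"
  shows "nu l x \<le> real n \<longleftrightarrow> x \<le> L l n"
proof -
  have "nu l x \<le> real n \<longleftrightarrow> sqrt (8 * real l * x + (real l - 2)\<^sup>2) \<le> 2 * real l * real n - (real l - 2)"
    using l by (simp add: nu_def field_simps)
  also have "\<dots> \<longleftrightarrow> 8 * real l * x + (real l - 2)\<^sup>2 \<le> (2 * real l * real n - (real l - 2))\<^sup>2"
  proof -
    have "real l * 1 \<le> real l * real n" using assms by (intro mult_left_mono) auto
    then have "2 * real l * real n - (real l - 2) \<ge> 0" by simp
    then show ?thesis using assms
      by (metis real_sqrt_le_iff real_sqrt_unique)
  qed
  also have "(2 * real l * real n - (real l - 2))\<^sup>2 = 8 * real l * L l n + (real l - 2)\<^sup>2"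
    by (simp add: L_def field_simps power2_eq_square)
  finally show ?thesis using l by simp
qed

text \<open>With \<open>nu l x > 1\<close> the ceiling is at least 2, so \<open>nat\<close> changes
  nothing and \<open>nu_le_iff\<close> applies at the preceding index too.\<close>

lemma n_idx_bounds:
  assumes "x \<ge> 0" "nu l x > 1"
  shows "n_idx l x \<ge> 2" "L l (n_idx l x - 1) < x" "x \<le> L l (n_idx l x)"
proof -
  have "\<lceil>nu l x\<rceil> \<ge> 2" using assms by linarith
  then show n: "n_idx l x \<ge> 2" unfolding n_idx_def by linarith
  have "real (n_idx l x) = of_int \<lceil>nu l x\<rceil>" using \<open>\<lceil>nu l x\<rceil> \<ge> 2\<close> by (simp add: n_idx_def)
  then have "nu l x \<le> real (n_idx l x)" "nu l x > real (n_idx l x - 1)"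
    using n by (simp_all add: of_nat_diff) linarith+
  then show "L l (n_idx l x - 1) < x" "x \<le> L l (n_idx l x)"
    using nu_le_iff[OF assms(1), of "n_idx l x"] nu_le_iff[OF assms(1), of "n_idx l x - 1"] n
    by (auto simp: not_le[symmetric])
qed

lemma filterlim_n_idx: "filterlim (n_idx l) sequentially at_top"
  unfolding filterlim_at_top
proof
  fix N :: nat
  show "\<forall>\<^sub>F x in at_top. N \<le> n_idx l x"
    using filterlim_at_top[THEN iffD1, OF filterlim_nu, rule_format, of "real N"]
    by eventually_elim (unfold n_idx_def, linarith)
qed

text \<open>\<open>2 * l * L l n\<close> is squeezed between nearby squares, which puts
  \<open>sqrt (2 * l * x)\<close> between \<open>l * (n - 1)\<close> and
  \<open>l * (n + 1) + 1\<close>.\<close>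

lemma index_approx_sqrt:
  assumes n: "n > 0" and x: "L l n < x" "x \<le> L l (Suc n)"
  shows "\<bar>real l * real (Suc n) - sqrt (2 * real l * x)\<bar> \<le> 2 * real l + 1"
proof -
  have "(real l * (real n - 1))\<^sup>2 \<le> 2 * real l * L l n"
  proof -
    have "2 * real l * L l n - (real l * (real n - 1))\<^sup>2 = real l * (real l * (real n - 1) + 2 * real n)"
      by (simp add: L_def field_simps power2_eq_square)
    also have "\<dots> \<ge> 0" using n by (intro mult_nonneg_nonneg add_nonneg_nonneg) auto
    finally show ?thesis by simp
  qed
  also have "\<dots> \<le> 2 * real l * x" using x by (intro mult_left_mono) auto
  finally have 1: "real l * (real n - 1) \<le> sqrt (2 * real l * x)" by (rule real_le_rsqrt)
  have "2 * real l * x \<le> 2 * real l * L l (Suc n)" using x by (intro mult_left_mono) auto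
  also have "\<dots> \<le> (real l * real (Suc n) + 1)\<^sup>2"
    by (simp add: L_def field_simps power2_eq_square)
  finally have "sqrt (2 * real l * x) \<le> real l * real (Suc n) + 1" by (intro real_le_lsqrt) auto
  with 1 show ?thesis by (simp add: algebra_simps)
qed

section \<open>The error at the points \<open>L l n\<close>\<close>

lemma error_at_L:
  "(\<lambda>n. li (L l n) - Sigma_sum l n - real l * real n / (ln (L l n))\<^sup>2) \<in> O(\<lambda>n. real n / ln (L l n) ^ 3)"
    (is "?u \<in> O(?G)")
proof -
  define F where "F = (\<lambda>n. real l * real n / (ln (L l n))\<^sup>2)"
  define U where "U = (\<lambda>n. (h l n)\<^sup>2 / (2 * L l n * (ln (L l n))\<^sup>2) - (F (Suc n) - F n))"
  define V where "V = (\<lambda>n. (h l n)\<^sup>2 / (2 * L l (Suc n) * (ln (L l (Suc n)))\<^sup>2) - (F (Suc n) - F n))"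
  have "U \<in> O(\<lambda>n. ?G (Suc n) - ?G n)" "V \<in> O(\<lambda>n. ?G (Suc n) - ?G n)"
    unfolding U_def V_def F_def
    by (rule landau_o.big_trans[OF increment_asymptotics(1) comparison_increment(1)]
             landau_o.big_trans[OF increment_asymptotics(2) comparison_increment(1)])+
  then obtain c d where c: "\<forall>\<^sub>F n in sequentially. norm (U n) \<le> c * norm (?G (Suc n) - ?G n)"
    and d: "\<forall>\<^sub>F n in sequentially. norm (V n) \<le> d * norm (?G (Suc n) - ?G n)"
    by (auto elim!: landau_o.bigE)
  \<comment> \<open>The increment of \<open>?u\<close> lies between \<open>V n\<close> and
    \<open>U n\<close>. The restriction \<open>n > 1\<close> avoids \<open>L l 1 = 1\<close>, where
    the logarithm vanishes.\<close>
  have "\<forall>\<^sub>F n in sequentially. \<bar>?u (Suc n) - ?u n\<bar> \<le> max c d * (?G (Suc n) - ?G n)"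
    using c d comparison_increment(2) eventually_gt_at_top[of 1]
  proof eventually_elim
    case (elim n)
    have "1 < L l n"
      using L_Suc_bounds[of "n - 1"] elim by simp
    moreover have "L l n < L l (Suc n)"
      using L_Suc_bounds elim by simp
    ultimately have bounds:
      "(h l n)\<^sup>2 / (2 * L l (Suc n) * (ln (L l (Suc n)))\<^sup>2) \<le> li (L l (Suc n)) - li (L l n) - s l n"
      "li (L l (Suc n)) - li (L l n) - s l n \<le> (h l n)\<^sup>2 / (2 * L l n * (ln (L l n))\<^sup>2)"
      using li_increment_bounds[of "L l n" "L l (Suc n)"] by (auto simp: h_def s_def)
    have "?u (Suc n) - ?u n = li (L l (Suc n)) - li (L l n) - s l n - (F (Suc n) - F n)"
      using elim by (simp add: Sigma_sum_def F_def)
    then have "V n \<le> ?u (Suc n) - ?u n" "?u (Suc n) - ?u n \<le> U n"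
      using bounds by (auto simp: U_def V_def)
    moreover have "c * (?G (Suc n) - ?G n) \<le> max c d * (?G (Suc n) - ?G n)"
      "d * (?G (Suc n) - ?G n) \<le> max c d * (?G (Suc n) - ?G n)"
      using elim by (auto intro!: mult_right_mono)
    ultimately show ?case
      using elim by auto
  qed
  then show ?thesis
    by (rule bigo_telescoping) (rule comparison_increment(3))
qed

section \<open>Passage from \<open>L l n\<close> to arbitrary x\<close>

lemma eventually_index_interval:
  "\<forall>\<^sub>F x in at_top. \<exists>n. n_idx l x = Suc n \<and> n > 1 \<and> L l n < x \<and> x \<le> L l (Suc n)"
proof -
  have "\<forall>\<^sub>F x in at_top. n_idx l x > 2"
    using eventually_compose_filterlim[OF eventually_gt_at_top filterlim_n_idx] .
  then show ?thesis
    using eventually_ge_at_top[of 0] filterlim_at_top_dense[THEN iffD1, OF filterlim_nu, rule_format, of 1]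
  proof eventually_elim
    case (elim x)
    then show ?case
      using n_idx_bounds[of x] by (intro exI[of _ "n_idx l x - 1"]) auto
  qed
qed

lemma filterlim_pred_n_idx: "filterlim (\<lambda>x. n_idx l x - 1) sequentially at_top"
  by (rule filterlim_compose[OF filterlim_minus_const_nat_at_top filterlim_n_idx])

text \<open>On the last interval the estimator is linear with slope
  \<open>1 / ln (L l (n_idx l x))\<close>, so the Taylor bounds apply to the piece from
  \<open>x\<close> to the right end. It is no longer than a full step and starts beyond
  \<open>L l n\<close>.\<close>

lemma interpolation_error_bounded:
  "(\<lambda>x. li (L l (n_idx l x)) - li x - (L l (n_idx l x) - x) / ln (L l (n_idx l x))) \<in> O[at_top](\<lambda>_. 1)"
    (is "?R \<in> _")
proof -
  let ?U = "\<lambda>n. (h l n)\<^sup>2 / (2 * L l n * (ln (L l n))\<^sup>2)"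
  have "\<forall>\<^sub>F x in at_top. norm (?R x) \<le> norm (?U (n_idx l x - 1))"
    using eventually_index_interval
  proof eventually_elim
    case (elim x)
    then obtain n where n: "n_idx l x = Suc n" "n > 1" "L l n < x" "x \<le> L l (Suc n)"
      by blast
    have L: "1 < L l n"
      using L_Suc_bounds[of "n - 1"] n by simp
    have "0 \<le> (L l (Suc n) - x)\<^sup>2 / (2 * L l (Suc n) * (ln (L l (Suc n)))\<^sup>2)"
      using n L by simp
    also have "\<dots> \<le> ?R x"
      using li_increment_bounds(1)[of x "L l (Suc n)"] n L by simp
    finally have "0 \<le> ?R x" .
    have "?R x \<le> (L l (Suc n) - x)\<^sup>2 / (2 * x * (ln x)\<^sup>2)"
      using li_increment_bounds(2)[of x "L l (Suc n)"] n L by simp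
    also have "\<dots> \<le> ?U n"
      using n L by (intro frac_le power_mono mult_mono mult_pos_pos) (auto simp: h_def)
    finally have "\<bar>?R x\<bar> \<le> \<bar>?U n\<bar>"
      using \<open>0 \<le> ?R x\<close> by linarith
    then show ?case
      using n(1) by simp
  qed
  moreover have "(\<lambda>x. ?U (n_idx l x - 1)) \<in> O[at_top](\<lambda>_. 1)"
    using landau_o.big.compose[OF step_error_bounded filterlim_pred_n_idx] .
  ultimately show ?thesis
    by (rule landau_o.big_trans[OF landau_o.big_mono])
qed

text \<open>The logarithm is changed first, with the index kept, and then the index is replaced by
  the square root. The first change is monotone in \<open>x\<close>, hence at most its value over a
  full step.\<close>

lemma main_term_transfer:
  "(\<lambda>x. real l * real (n_idx l x) / (ln (L l (n_idx l x)))\<^sup>2 - sqrt (2 * real l * x) / (ln x)\<^sup>2)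
     \<in> O[at_top](\<lambda>_. 1)" (is "?f \<in> _")
proof -
  let ?W = "\<lambda>n. real l * real (Suc n) * (1 / (ln (L l n))\<^sup>2 - 1 / (ln (L l (Suc n)))\<^sup>2)"
  have "\<forall>\<^sub>F x in at_top. norm (?f x) \<le> norm (\<bar>?W (n_idx l x - 1)\<bar> + (2 * real l + 1))"
    using eventually_index_interval eventually_ge_at_top[of "exp 1"]
  proof eventually_elim
    case (elim x)
    then obtain n where n: "n_idx l x = Suc n" "n > 1" "L l n < x" "x \<le> L l (Suc n)"
      by blast
    have L: "1 < L l n"
      using L_Suc_bounds[of "n - 1"] n by simp
    have "ln x \<ge> 1"
      using elim(2) by (subst ln_ge_iff) (auto intro: less_le_trans[of 0 "exp 1"])
    define d where "d = real l * real (Suc n) - sqrt (2 * real l * x)"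
    have d: "\<bar>d\<bar> \<le> 2 * real l + 1"
      unfolding d_def using index_approx_sqrt[of n x] n by simp
    \<comment> \<open>From \<open>x \<ge> exp 1\<close> on, dividing by \<open>(ln x)^2\<close>
      cannot enlarge \<open>d\<close>.\<close>
    have "\<bar>d\<bar> / (ln x)\<^sup>2 \<le> \<bar>d\<bar> / 1"
      using \<open>ln x \<ge> 1\<close> by (intro divide_left_mono) auto
    with d have 1: "\<bar>d / (ln x)\<^sup>2\<bar> \<le> 2 * real l + 1"
      by (simp add: abs_divide)
    have "1 / (ln (L l (Suc n)))\<^sup>2 \<le> 1 / (ln x)\<^sup>2" "1 / (ln x)\<^sup>2 \<le> 1 / (ln (L l n))\<^sup>2"
      using n L by (auto intro!: divide_left_mono power_mono)
    then have "\<bar>1 / (ln (L l (Suc n)))\<^sup>2 - 1 / (ln x)\<^sup>2\<bar> \<le> \<bar>1 / (ln (L l n))\<^sup>2 - 1 / (ln (L l (Suc n)))\<^sup>2\<bar>"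
      by linarith
    then have 2: "\<bar>real l * real (Suc n) * (1 / (ln (L l (Suc n)))\<^sup>2 - 1 / (ln x)\<^sup>2)\<bar> \<le> \<bar>?W n\<bar>"
      unfolding abs_mult by (intro mult_left_mono) auto
    have "?f x = real l * real (Suc n) * (1 / (ln (L l (Suc n)))\<^sup>2 - 1 / (ln x)\<^sup>2) + d / (ln x)\<^sup>2"
      using n by (simp add: d_def right_diff_distrib diff_divide_distrib)
    then have "\<bar>?f x\<bar> \<le> \<bar>?W n\<bar> + (2 * real l + 1)"
      using 1 2 by linarith
    then show ?case
      using n(1) by simp
  qed
  moreover have "(\<lambda>x. ?W (n_idx l x - 1)) \<in> O[at_top](\<lambda>_. 1)"
    using landau_o.big.compose[OF main_term_step_bounded filterlim_pred_n_idx] .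
  then have "(\<lambda>x. \<bar>?W (n_idx l x - 1)\<bar> + (2 * real l + 1)) \<in> O[at_top](\<lambda>_. 1)"
    by (intro sum_in_bigo) auto
  ultimately show ?thesis
    by (rule landau_o.big_trans[OF landau_o.big_mono])
qed

text \<open>The index is at most \<open>sqrt (2 * l * x) + 2 * l + 1\<close>, and
  \<open>1 \<le> sqrt x\<close> turns the additive constant into a multiple of
  \<open>sqrt x\<close>. The logarithm only decreases when the right end is replaced by
  \<open>x\<close>.\<close>

lemma comparison_transfer:
  "(\<lambda>x. real (n_idx l x) / ln (L l (n_idx l x)) ^ 3) \<in> O[at_top](\<lambda>x. sqrt x / ln x ^ 3)"
proof (rule bigoI[where c = "sqrt (2 * real l) + (2 * real l + 1)"])
  show "\<forall>\<^sub>F x in at_top. norm (real (n_idx l x) / ln (L l (n_idx l x)) ^ 3) \<le>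
      (sqrt (2 * real l) + (2 * real l + 1)) * norm (sqrt x / ln x ^ 3)"
    using eventually_index_interval
  proof eventually_elim
    case (elim x)
    then obtain n where n: "n_idx l x = Suc n" "n > 1" "L l n < x" "x \<le> L l (Suc n)"
      by blast
    have "1 < x"
      using L_Suc_bounds[of "n - 1"] n by simp
    have "real (Suc n) \<le> real l * real (Suc n)"
      using l by simp
    also have "\<dots> \<le> sqrt (2 * real l * x) + (2 * real l + 1) * 1"
      using index_approx_sqrt[of n x] n by simp
    also have "\<dots> \<le> sqrt (2 * real l) * sqrt x + (2 * real l + 1) * sqrt x"
      using \<open>1 < x\<close> by (intro add_mono mult_left_mono) (auto simp: real_sqrt_mult)
    finally have *: "real (Suc n) \<le> (sqrt (2 * real l) + (2 * real l + 1)) * sqrt x"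
      by (simp add: distrib_right)
    have "real (Suc n) / ln (L l (Suc n)) ^ 3 \<le> (sqrt (2 * real l) + (2 * real l + 1)) * sqrt x / ln x ^ 3"
      using * n \<open>1 < x\<close> by (intro frac_le power_mono zero_less_power) auto
    then show ?case
      using n \<open>1 < x\<close> by simp
  qed
qed

end

theorem theorem4p5:
  fixes l :: nat
  assumes "l \<ge> 1"
  shows "(\<lambda>x::real. D l x - sqrt (2 * real l * x) / (ln x)\<^sup>2)
           \<in> O[at_top](\<lambda>x. sqrt x / (ln x) ^ 3)"
proof -
  have l: "l > 0"
    using assms by simp
  have one: "(\<lambda>_. 1) \<in> O[at_top](\<lambda>x::real. sqrt x / (ln x) ^ 3)"
    by real_asymp
  have "(\<lambda>x. li (L l (n_idx l x)) - Sigma_sum l (n_idx l x) -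
      real l * real (n_idx l x) / (ln (L l (n_idx l x)))\<^sup>2) \<in> O[at_top](\<lambda>x. sqrt x / (ln x) ^ 3)"
    using landau_o.big.compose[OF error_at_L[OF l] filterlim_n_idx[OF l]] comparison_transfer[OF l]
    by (rule landau_o.big_trans)
  \<comment> \<open>The values of \<open>li\<close> at the right end and the terms in
    \<open>l * n_idx l x\<close> cancel, leaving \<open>D l x\<close> minus its main term.\<close>
  then have "(\<lambda>x. li (L l (n_idx l x)) - Sigma_sum l (n_idx l x) -
        real l * real (n_idx l x) / (ln (L l (n_idx l x)))\<^sup>2 -
      (li (L l (n_idx l x)) - li x - (L l (n_idx l x) - x) / ln (L l (n_idx l x))) +
      (real l * real (n_idx l x) / (ln (L l (n_idx l x)))\<^sup>2 - sqrt (2 * real l * x) / (ln x)\<^sup>2))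
        \<in> O[at_top](\<lambda>x. sqrt x / (ln x) ^ 3)"
    by (intro sum_in_bigo(1)[OF sum_in_bigo(2)]
              landau_o.big_trans[OF interpolation_error_bounded[OF l] one]
              landau_o.big_trans[OF main_term_transfer[OF l] one])
  then show ?thesis
    by (simp add: D_def S_hat_def algebra_simps)
qed

end
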